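(* Let $W$ be a finite Weyl group with set of simple reflections $S=\{s_1,\dots,s_n\}$, and let $W_J$ be the standard parabolic subgroup generated by a subset $J\subseteq S$. Let $W^J$ denote the set of minimal length representatives of the left cosets in $W/W_J$. Then the language $\mathcal L(W^J)$, consisting of all reduced words over the alphabet $S$ representing the elements of $W^J$, is a regular language.
   Context: $W^J=\{w\in W:\ell(ws_j)>\ell(w)\text{ for all }s_j\in J\}$, where $\ell$ is the length function with respect to $S$. Convention on words: the word $s_{i_1}s_{i_2}\cdots s_{i_t}$ over the alphabet $S$, read from left to right, represents the group element $s_{i_t}\cdots s_{i_2}s_{i_1}$ (each newly read letter multiplies on the left); it is reduced if $t$ equals the length of this element. For example, in type $A_2$ with $J=\{s_1\}$ one has $W^J=\{e,s_2,s_1s_2\}$ and $\mathcal L(W^J)=\{\varepsilon,\,s_2,\,s_2s_1\}$. A language is regular if it is recognized by a deterministic finite automaton. *)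

theory Defs
  imports "HOL-Analysis.Analysis" "HOL-Algebra.Bij" "HOL-Algebra.Elementary_Groups"
begin

section \<open>Finite Weyl groups\<close>

definition reflection :: "'a::real_inner \<Rightarrow> 'a \<Rightarrow> 'a" where
  "reflection \<alpha> = (\<lambda>v. v - (2 * (v \<bullet> \<alpha>) / (\<alpha> \<bullet> \<alpha>)) *\<^sub>R \<alpha>)"

text \<open>Finite, reduced, crystallographic. The roots are not required to span the ambient space,
  so \<open>\<Phi>\<close> is a root system in \<^term>\<open>span \<Phi>\<close>; every reflection fixes the orthogonal complement
  pointwise. This keeps the empty root system, whose Weyl group is trivial.\<close>

definition root_system :: "'a::real_inner set \<Rightarrow> bool" where
  "root_system \<Phi> \<longleftrightarrow>
     finite \<Phi> \<and> 0 \<notin> \<Phi> \<and>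
     (\<forall>\<alpha>\<in>\<Phi>. reflection \<alpha> ` \<Phi> = \<Phi>) \<and>
     (\<forall>\<alpha>\<in>\<Phi>. \<Phi> \<inter> span {\<alpha>} = {\<alpha>, -\<alpha>}) \<and>
     (\<forall>\<alpha>\<in>\<Phi>. \<forall>\<beta>\<in>\<Phi>. 2 * (\<beta> \<bullet> \<alpha>) / (\<alpha> \<bullet> \<alpha>) \<in> \<int>)"

definition simple_system :: "'a::real_inner set \<Rightarrow> 'a set \<Rightarrow> bool" where
  "simple_system \<Phi> \<Delta> \<longleftrightarrow>
     \<Delta> \<subseteq> \<Phi> \<and> independent \<Delta> \<and>
     (\<forall>\<beta>\<in>\<Phi>. \<exists>c :: 'a \<Rightarrow> nat.
        \<beta> = (\<Sum>\<alpha>\<in>\<Delta>. real (c \<alpha>) *\<^sub>R \<alpha>) \<or> \<beta> = - (\<Sum>\<alpha>\<in>\<Delta>. real (c \<alpha>) *\<^sub>R \<alpha>))"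

definition weyl_group :: "'a::real_inner set \<Rightarrow> ('a \<Rightarrow> 'a) monoid" where
  "weyl_group \<Phi> = subgroup_generated (BijGroup UNIV) (reflection ` \<Phi>)"

definition simple_reflections :: "'a::real_inner set \<Rightarrow> ('a \<Rightarrow> 'a) set" where
  "simple_reflections \<Delta> = reflection ` \<Delta>"


section \<open>Words in a generating set\<close>

text \<open>Each newly read letter multiplies on the left: \<open>[s\<^sub>1, s\<^sub>2, \<dots>, s\<^sub>t]\<close> represents
  \<open>s\<^sub>t \<cdots> s\<^sub>2 s\<^sub>1\<close>.\<close>

definition word_value :: "('g, 'm) monoid_scheme \<Rightarrow> 'g list \<Rightarrow> 'g" where
  "word_value G ws = foldl (\<lambda>w s. s \<otimes>\<^bsub>G\<^esub> w) \<one>\<^bsub>G\<^esub> ws"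

definition word_length :: "('g, 'm) monoid_scheme \<Rightarrow> 'g set \<Rightarrow> 'g \<Rightarrow> nat" where
  "word_length G S w = (LEAST k. \<exists>ws \<in> lists S. word_value G ws = w \<and> length ws = k)"

definition reduced_word :: "('g, 'm) monoid_scheme \<Rightarrow> 'g set \<Rightarrow> 'g list \<Rightarrow> bool" where
  "reduced_word G S ws \<longleftrightarrow>
     ws \<in> lists S \<and> length ws = word_length G S (word_value G ws)"

definition reduced_language :: "('g, 'm) monoid_scheme \<Rightarrow> 'g set \<Rightarrow> 'g set \<Rightarrow> 'g list set" where
  "reduced_language G S A = {ws. reduced_word G S ws \<and> word_value G ws \<in> A}"

text \<open>The set \<open>W\<^sup>J\<close>. For a Coxeter group these are the elements of minimal length in the left
  cosets of the subgroup generated by \<open>J\<close>.\<close>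

definition min_coset_reps :: "('g, 'm) monoid_scheme \<Rightarrow> 'g set \<Rightarrow> 'g set \<Rightarrow> 'g set" where
  "min_coset_reps G S J =
     {w \<in> carrier G. \<forall>s\<in>J. word_length G S (w \<otimes>\<^bsub>G\<^esub> s) > word_length G S w}"


section \<open>Regular languages\<close>

record ('q, 'a) dfa =
  states :: "'q set"
  initial :: 'q
  accepting :: "'q set"
  next_state :: "'q \<Rightarrow> 'a \<Rightarrow> 'q"

definition is_dfa :: "'a set \<Rightarrow> ('q, 'a) dfa \<Rightarrow> bool" where
  "is_dfa \<Sigma> M \<longleftrightarrow>
     finite \<Sigma> \<and> finite (states M) \<and> initial M \<in> states M \<and> accepting M \<subseteq> states M \<and>
     (\<forall>q\<in>states M. \<forall>a\<in>\<Sigma>. next_state M q a \<in> states M)"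

definition dfa_language :: "'a set \<Rightarrow> ('q, 'a) dfa \<Rightarrow> 'a list set" where
  "dfa_language \<Sigma> M = {ws \<in> lists \<Sigma>. foldl (next_state M) (initial M) ws \<in> accepting M}"

text \<open>Taking natural numbers as states is no restriction, since state sets are finite.\<close>

definition regular_language :: "'a set \<Rightarrow> 'a list set \<Rightarrow> bool" where
  "regular_language \<Sigma> L \<longleftrightarrow> (\<exists>M :: (nat, 'a) dfa. is_dfa \<Sigma> M \<and> L = dfa_language \<Sigma> M)"

end

theory Submission
  imports Defs
begin

text \<open>A Weyl group is finite: its elements are linear, permute the finite set of roots and fix the
  orthogonal complement of the roots, so they are determined by their action on the roots. Reduced
  words therefore have bounded length, and over a finite alphabet they form a finite, hence regular,
  language.\<close>

text \<open>\<open>regular_language\<close> asks for natural numbers as states. A finite state set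
  embeds into them and the transitions are carried along, so automata may be built over any
  convenient state type.\<close>

lemma regular_language_dfa_language:
  fixes M :: "('q, 'a) dfa"
  assumes "is_dfa \<Sigma> M"
  shows "regular_language \<Sigma> (dfa_language \<Sigma> M)"
proof -
  have fin: "finite \<Sigma>" "finite (states M)" and init: "initial M \<in> states M"
    and acc: "accepting M \<subseteq> states M"
    and step: "\<And>q a. q \<in> states M \<Longrightarrow> a \<in> \<Sigma> \<Longrightarrow> next_state M q a \<in> states M"
    using assms by (auto simp: is_dfa_def)
  obtain f :: "'q \<Rightarrow> nat" where f: "inj_on f (states M)"
    using finite_imp_inj_to_nat_seg[OF fin(2)] by blast
  define N :: "(nat, 'a) dfa" where
    "N = \<lparr>states = f ` states M, initial = f (initial M), accepting = f ` accepting M,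
          next_state = (\<lambda>q. \<lambda>a. f (next_state M (inv_into (states M) f q) a))\<rparr>"
  have "is_dfa \<Sigma> N"
    using fin init acc step f by (auto simp: is_dfa_def N_def)
  \<comment> \<open>The start state is arbitrary because reading a letter changes it in the
    induction. Staying inside \<open>states M\<close> is proved together with the simulation, since
    \<open>inv_into\<close> undoes \<open>f\<close> only there.\<close>
  moreover have "foldl (next_state M) q ws \<in> states M \<and>
      foldl (next_state N) (f q) ws = f (foldl (next_state M) q ws)"
    if "q \<in> states M" "ws \<in> lists \<Sigma>" for q ws
    using that(2,1) by (induction arbitrary: q) (auto simp: N_def step f)
  then have "foldl (next_state N) (initial N) ws \<in> accepting N \<longleftrightarrow>
      foldl (next_state M) (initial M) ws \<in> accepting M" if "ws \<in> lists \<Sigma>" for ws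
    using that init acc inj_on_image_mem_iff[OF f, of "foldl (next_state M) (initial M) ws"]
    by (simp add: N_def)
  then have "dfa_language \<Sigma> M = dfa_language \<Sigma> N"
    by (auto simp: dfa_language_def)
  ultimately show ?thesis
    unfolding regular_language_def by blast
qed

lemma regular_language_bounded_length:
  assumes "finite \<Sigma>" "L \<subseteq> lists \<Sigma>" "\<And>ws. ws \<in> L \<Longrightarrow> length ws \<le> n"
  shows "regular_language \<Sigma> L"
proof -
  \<comment> \<open>All words longer than \<open>n\<close> are rejected, so it suffices to remember the first \<open>n + 1\<close> letters.\<close>
  define M :: "('a list, 'a) dfa" where
    "M = \<lparr>states = {ws. set ws \<subseteq> \<Sigma> \<and> length ws \<le> Suc n}, initial = [], accepting = L,
          next_state = (\<lambda>ws a. take (Suc n) (ws @ [a]))\<rparr>"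
  have "is_dfa \<Sigma> M"
    using assms finite_lists_length_le[OF assms(1), of "Suc n"]
    by (fastforce simp: is_dfa_def M_def le_Suc_eq dest: in_set_takeD)
  moreover have "foldl (next_state M) [] ws = take (Suc n) ws" for ws
  proof (induction ws rule: rev_induct)
    case (snoc a ws)
    then show ?case by (cases "Suc n \<le> length ws") (auto simp: M_def)
  qed simp
  \<comment> \<open>A word longer than \<open>n\<close> is cut to length exactly
    \<open>n + 1\<close>, still too long for \<open>L\<close>; cutting at \<open>n\<close> could
    turn it into a word of \<open>L\<close>.\<close>
  moreover have "take (Suc n) ws \<in> L \<longleftrightarrow> ws \<in> L" for ws
    using assms(3)[of ws] assms(3)[of "take (Suc n) ws"]
    by (cases "length ws \<le> n") auto
  ultimately show ?thesis
    using regular_language_dfa_language[of \<Sigma> M] assms(2)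
    by (auto simp: dfa_language_def M_def subset_iff Int_def conj_commute cong: conj_cong)
qed

lemma word_value_closed:
  assumes "monoid G" "S \<subseteq> carrier G" "ws \<in> lists S"
  shows "word_value G ws \<in> carrier G"
proof -
  have "foldl (\<lambda>w s. s \<otimes>\<^bsub>G\<^esub> w) g ws \<in> carrier G" if "g \<in> carrier G" for g
    using assms(3) that assms(2)
    by (induction arbitrary: g) (auto intro!: monoid.m_closed[OF assms(1)])
  then show ?thesis
    using monoid.one_closed[OF assms(1)] by (simp add: word_value_def)
qed

text \<open>A reduced word is as long as the \<open>word_length\<close> of its value, and this
  function has a maximum on a finite carrier.\<close>

lemma regular_language_reduced_language:
  assumes "monoid G" "finite (carrier G)" "S \<subseteq> carrier G"
  shows "regular_language S (reduced_language G S A)"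
proof (rule regular_language_bounded_length)
  show "finite S" using assms finite_subset by blast
  show "reduced_language G S A \<subseteq> lists S"
    by (auto simp: reduced_language_def reduced_word_def)
  fix ws assume "ws \<in> reduced_language G S A"
  then show "length ws \<le> Max (word_length G S ` carrier G)"
    using word_value_closed[OF assms(1,3)] assms(2)
    by (auto simp: reduced_language_def reduced_word_def)
qed

lemma linear_reflection: "linear (reflection \<alpha>)"
  unfolding reflection_def
  by (rule linearI) (simp_all add: algebra_simps inner_add_left add_divide_distrib)

lemma reflection_reflection:
  assumes "\<alpha> \<noteq> 0"
  shows "reflection \<alpha> (reflection \<alpha> v) = v"
  using assms by (simp add: reflection_def inner_diff_left)

lemma reflection_in_Bij:
  assumes "\<alpha> \<noteq> 0"
  shows "reflection \<alpha> \<in> Bij UNIV"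
  using o_bij[of "reflection \<alpha>" "reflection \<alpha>"] reflection_reflection[OF assms]
  by (auto simp: Bij_def fun_eq_iff)

lemma BijGroup_UNIV_mult:
  "f \<in> Bij UNIV \<Longrightarrow> g \<in> Bij UNIV \<Longrightarrow> f \<otimes>\<^bsub>BijGroup UNIV\<^esub> g = f \<circ> g"
  by (auto simp: BijGroup_def compose_def fun_eq_iff)

lemma finite_weyl_group:
  fixes \<Phi> :: "'a::euclidean_space set"
  assumes "root_system \<Phi>"
  shows "finite (carrier (weyl_group \<Phi>))"
proof -
  interpret B: group "BijGroup (UNIV :: 'a set)" by (rule group_BijGroup)
  have carrier_B: "carrier (BijGroup UNIV) = Bij (UNIV :: 'a set)"
    by (simp add: BijGroup_def)
  have \<Phi>: "finite \<Phi>" "0 \<notin> \<Phi>" and refl: "\<And>\<alpha>. \<alpha> \<in> \<Phi> \<Longrightarrow> reflection \<alpha> ` \<Phi> = \<Phi>"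
    using assms by (auto simp: root_system_def)
  \<comment> \<open>An invariant of all products of reflections, strong enough to leave only
    finitely many maps.\<close>
  define P where "P w \<longleftrightarrow> linear w \<and> w ` \<Phi> = \<Phi> \<and> (\<forall>v. (\<forall>\<beta>\<in>\<Phi>. v \<bullet> \<beta> = 0) \<longrightarrow> w v = v)" for w :: "'a \<Rightarrow> 'a"
  have P_refl: "P (reflection \<alpha>)" if "\<alpha> \<in> \<Phi>" for \<alpha>
    using that refl linear_reflection by (auto simp: P_def reflection_def)
  have P: "P w" if "w \<in> generate (BijGroup UNIV) (reflection ` \<Phi>)" for w
    using that
  proof (induction rule: generate.induct)
    case one
    show ?case by (simp add: P_def BijGroup_def linear_iff)
  next
    case (incl h)
    then show ?case using P_refl by blast
  next
    \<comment> \<open>\<open>generate\<close> also adds inverses of generators; a reflection is its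
      own inverse.\<close>
    case (inv h)
    then obtain \<alpha> where \<alpha>: "\<alpha> \<in> \<Phi>" "h = reflection \<alpha>" by blast
    then have "h \<in> Bij UNIV" using \<Phi> reflection_in_Bij by metis
    moreover have "h \<circ> h = id"
      using \<alpha> \<Phi> reflection_reflection[of \<alpha>] by (auto simp: fun_eq_iff)
    ultimately have "inv\<^bsub>BijGroup UNIV\<^esub> h = h"
      by (intro B.inv_equality)
        (auto simp: carrier_B BijGroup_UNIV_mult, auto simp: BijGroup_def fun_eq_iff)
    then show ?case using \<alpha> P_refl by simp
  next
    case (eng g h)
    have "reflection ` \<Phi> \<subseteq> carrier (BijGroup UNIV)"
      using \<Phi> by (auto simp: carrier_B intro!: reflection_in_Bij)
    then have "g \<in> Bij UNIV" "h \<in> Bij UNIV"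
      using eng.hyps B.generate_in_carrier carrier_B by blast+
    then have "g \<otimes>\<^bsub>BijGroup UNIV\<^esub> h = g \<circ> h"
      by (rule BijGroup_UNIV_mult)
    then show ?case
      using eng.IH linear_compose[of h g] unfolding P_def by (metis comp_apply image_comp)
  qed
  \<comment> \<open>Restriction makes the maps \<open>undefined\<close> off the roots, so that they
    lie in the finite set of extensional functions from \<Phi> to itself.\<close>
  have "inj_on (\<lambda>w. restrict w \<Phi>) {w. P w}"
  proof (rule inj_onI, rule ext)
    fix f g v assume "f \<in> {w. P w}" "g \<in> {w. P w}" and eq: "restrict f \<Phi> = restrict g \<Phi>"
    then have fg: "P f" "P g" by auto
    \<comment> \<open>Agreement on the roots extends linearly to \<open>y\<close>, while both maps
      fix \<open>z\<close>, which is orthogonal to every root.\<close>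
    obtain y z where v: "y \<in> span \<Phi>" "\<And>u. u \<in> span \<Phi> \<Longrightarrow> orthogonal z u" "v = y + z"
      using orthogonal_subspace_decomp_exists by metis
    have "f \<beta> = g \<beta>" if "\<beta> \<in> \<Phi>" for \<beta>
      using fun_cong[OF eq, of \<beta>] that by simp
    then have "f y = g y"
      using linear_eq_on_span[of f g \<Phi> y] v(1) fg by (auto simp: P_def)
    moreover have "f z = z" "g z = z"
      using fg v(2) by (auto simp: P_def orthogonal_def span_base)
    ultimately show "f v = g v"
      using fg v(3) by (simp add: P_def linear_add)
  qed
  moreover have "(\<lambda>w. restrict w \<Phi>) ` {w. P w} \<subseteq> \<Phi> \<rightarrow>\<^sub>E \<Phi>"
    by (auto simp: P_def)
  ultimately have "finite {w. P w}"
    using \<Phi>(1) by (metis finite_PiE inj_on_finite)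
  \<comment> \<open>\<open>subgroup_generated\<close> first intersects the generators with the
    carrier; monotonicity of \<open>generate\<close> removes this intersection.\<close>
  moreover have "carrier (weyl_group \<Phi>) \<subseteq> {w. P w}"
    using P B.mono_generate[of "carrier (BijGroup UNIV) \<inter> reflection ` \<Phi>" "reflection ` \<Phi>"]
    by (auto simp: weyl_group_def carrier_subgroup_generated)
  ultimately show ?thesis by (rule finite_subset[rotated])
qed

theorem theorem3p12:
  fixes \<Phi> \<Delta> :: "'a::euclidean_space set" and J :: "('a \<Rightarrow> 'a) set"
  assumes "root_system \<Phi>"
    and "simple_system \<Phi> \<Delta>"
    and "J \<subseteq> simple_reflections \<Delta>"
  shows "regular_language (simple_reflections \<Delta>)
           (reduced_language (weyl_group \<Phi>) (simple_reflections \<Delta>)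
             (min_coset_reps (weyl_group \<Phi>) (simple_reflections \<Delta>) J))"
proof (rule regular_language_reduced_language)
  show "monoid (weyl_group \<Phi>)"
    unfolding weyl_group_def
    by (intro group.is_monoid group.group_subgroup_generated group_BijGroup)
  show "finite (carrier (weyl_group \<Phi>))"
    by (rule finite_weyl_group[OF assms(1)])
  have "\<Delta> \<subseteq> \<Phi>" "0 \<notin> \<Phi>"
    using assms by (auto simp: simple_system_def root_system_def)
  \<comment> \<open>Roots are nonzero, so their reflections are bijections and survive the
    intersection with the carrier.\<close>
  then have "simple_reflections \<Delta> \<subseteq> carrier (BijGroup UNIV) \<inter> reflection ` \<Phi>"
    by (auto simp: simple_reflections_def BijGroup_def intro!: reflection_in_Bij)
  then show "simple_reflections \<Delta> \<subseteq> carrier (weyl_group \<Phi>)"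
    by (auto simp: weyl_group_def carrier_subgroup_generated intro: generate.incl)
qed

end
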